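(* Let $\mathcal{A}$ be a contract automaton in the flow setting described in the context, and let $k$ be an index of a principal of $\mathcal{A}$. Then $k\in W\!Liable(\mathcal{A})$ (i.e. the principal $\prod^k(\mathcal{A})$ is weakly liable) if and only if there exists a transition $\overline t=(\vec q_s,\vec a,\vec q_d)\in T$ with $\vec a_{(k)}\ne\Box$ such that $\gamma_{\overline t}<0$, where $\gamma_{\overline t}=\min\{g(\vec x)\mid \vec x\in F_{\vec q_0,\vec q_s},\ \vec y\in F_{\vec q_s,\vec q_f},\ \forall i\in I_l.\ \sum_{t_j\in T}a^i_{t_j}(x_{t_j}+y_{t_j})\ge 0\}$ and $g(\vec x)=\max\{\gamma\mid \vec u\in F_{\vec q_d,\vec q_f},\ \forall i\in I_l.\ \sum_{t_j\in T}a^i_{t_j}(x_{t_j}+u_{t_j})+a^i_{\overline t}\ge\gamma,\ \gamma\in\mathbb{R}\}$.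
   Context: Fix disjoint sets $\mathbb{R}$ (requests) and $\mathbb{O}$ (offers $\overline a$) and an idle symbol $\Box$; $\Sigma=\mathbb{R}\cup\mathbb{O}\cup\{\Box\}$, $co$ swaps $a$ and $\overline a$, fixes $\Box$. For $\vec v\in\Sigma^n$, $\vec v_{(i)}$ is its $i$-th entry. $\vec a\in\Sigma^n$ is a request (resp. offer) on $\alpha$ if $\vec a=\Box^{n_1}\alpha\Box^{n_2}$ with $\alpha\in\mathbb{R}$ (resp. $\mathbb{O}$), a match on $\alpha$ if $\vec a=\Box^{n_1}\alpha\Box^{n_2}co(\alpha)\Box^{n_3}$; $\vec a\bowtie\vec b$ iff $\vec a$ is a request or offer on some $\alpha$, and if an offer on $\alpha$ then $\vec b$ is a request on $co(\alpha)$, and if a request on $\alpha$ then $\vec b$ is an offer on $co(\alpha)$. A contract automaton (CA) of rank $r$ is $\langle Q,\vec q_0,A^r,A^o,T,F\rangle$, $Q=Q_1\times\cdots\times Q_r$ finite, $\vec q_0\in Q$, finite $A^r\subseteq\mathbb{R}$, $A^o\subseteq\mathbb{O}$, $F\subseteq Q$, $T\subseteq Q\times(A^r\cup A^o\cup\{\Box\})^r\times Q$ with labels requests, offers or matches and $\vec a_{(i)}=\Box\Rightarrow\vec q_{(i)}=\vec q'_{(i)}$. $\mathscr{L}(\mathcal{A})$: words of labels of paths from $\vec q_0$ to $F$. Observable of an action: its unique non-idle entry if a request or offer, $\tau$ if a match. $\mathfrak{W}$: words $w=\vec a_1\ldots\vec a_m\in(\Sigma^r)^*$, $r>1$, with a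 function $f:[1..m]\to[1..m]$ total and injective on the indices of request actions of $w$ and $f(i)=j$ only if $\vec a_i\bowtie\vec a_j$. Weak liability: if $w=w_1\vec aw_2\in\mathscr{L}(\mathcal{A})\setminus\mathfrak{W}$, for all $w'$ we have $ww'\notin\mathscr{L}(\mathcal{A})\cap\mathfrak{W}$, for all $w_3$ we have $w_1\vec aw_3\notin\mathscr{L}(\mathcal{A})\cap\mathfrak{W}$, and there is $w_4$ with $w_1w_4\in\mathscr{L}(\mathcal{A})\cap\mathfrak{W}$, then the indices $i$ with $\vec a_{(i)}\ne\Box$ are weakly liable and form $W\!Liable(\mathcal{A},w_1\vec a)$; $W\!Liable(\mathcal{A})=\{i\mid\exists w.\ i\in W\!Liable(\mathcal{A},w)\}$. Flow setting: $\mathcal{A}$ has a single final state $\vec q_f\ne\vec q_0$, every state is reachable from $\vec q_0$ and $\vec q_f$ is reachable from every state; $A^r=\{a^i\mid i\in I_l=\{1,\ldots,l\}\}$, $T=\{t_1,\ldots,t_n\}$. $FS(\vec q),BS(\vec q)$: transitions leaving/entering $\vec q$. For states $\vec s,\vec d$, $F_{\vec s,\vec d}$ is the set of $(x_{t_1},\ldots,x_{t_n})\in\mathbb{N}^n$ for which there exist reals $z^{\vec q}_{t_i}$ ($\vec q\ne\vec s$) with: for all $\vec q$, $\sum_{BS(\vec q)}x_{t_i}-\sum_{FS(\vec q)}x_{t_i}$ is $-1$ if $\vec q=\vec s$, $1$ if $\vec q=\vec d$, $0$ otherwise; $0\le z^{\vec q}_{t_i}\le x_{t_i}$; for all $\vec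 q\ne\vec s$ and $\vec q'$, $\sum_{BS(\vec q')}z^{\vec q}_{t_i}-\sum_{FS(\vec q')}z^{\vec q}_{t_i}$ is $-p^{\vec q}$ if $\vec q'=\vec s$, $p^{\vec q}$ if $\vec q'=\vec q$, $0$ otherwise, where $p^{\vec q}=1$ if $\sum_{FS(\vec q)}x_{t_i}>0$ and $0$ otherwise. For $t_j=(\vec q,\vec a,\vec q')$ and $i\in I_l$: $a^i_{t_j}=1$ if the observable of $\vec a$ is $\overline{a^i}$, $-1$ if it is $a^i$, $0$ otherwise.
   Formalization: The contract automaton is assumed deterministic (a state and a label have at most one successor), since the equivalence fails for nondeterministic ones; when s = d in F_{s,d} the clashing demands -1 and 1 are taken to cancel to 0; min and max are Inf and Sup in the extended reals. *)

theory Defs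
  imports Complex_Main "HOL-Library.Extended_Real"
begin

text \<open>
  Basic actions over a type of action names: \<open>Req a\<close> is the request \<open>a\<close>, \<open>Off a\<close> is the offer
  written $\overline a$, and \<open>Idle\<close> is the idle symbol. Vectors (of actions and of states) are
  lists, and the principals of an automaton of rank \<open>r\<close> are numbered \<open>0, \<dots>, r - 1\<close>.
\<close>

datatype 'a action = Req 'a | Off 'a | Idle

fun co :: "'a action \<Rightarrow> 'a action" where
  "co (Req a) = Off a"
| "co (Off a) = Req a"
| "co Idle = Idle"

definition is_request_on :: "'a action \<Rightarrow> 'a action list \<Rightarrow> bool" where
  "is_request_on \<alpha> v \<longleftrightarrow> \<alpha> \<in> range Req \<and>
     (\<exists>n1 n2. v = replicate n1 Idle @ [\<alpha>] @ replicate n2 Idle)"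

definition is_offer_on :: "'a action \<Rightarrow> 'a action list \<Rightarrow> bool" where
  "is_offer_on \<alpha> v \<longleftrightarrow> \<alpha> \<in> range Off \<and>
     (\<exists>n1 n2. v = replicate n1 Idle @ [\<alpha>] @ replicate n2 Idle)"

definition is_match_on :: "'a action \<Rightarrow> 'a action list \<Rightarrow> bool" where
  "is_match_on \<alpha> v \<longleftrightarrow> \<alpha> \<in> range Req \<union> range Off \<and>
     (\<exists>n1 n2 n3. v = replicate n1 Idle @ [\<alpha>] @ replicate n2 Idle @ [co \<alpha>] @ replicate n3 Idle)"

definition is_request :: "'a action list \<Rightarrow> bool" where
  "is_request v \<longleftrightarrow> (\<exists>\<alpha>. is_request_on \<alpha> v)"

definition is_offer :: "'a action list \<Rightarrow> bool" where
  "is_offer v \<longleftrightarrow> (\<exists>\<alpha>. is_offer_on \<alpha> v)"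

definition is_match :: "'a action list \<Rightarrow> bool" where
  "is_match v \<longleftrightarrow> (\<exists>\<alpha>. is_match_on \<alpha> v)"

definition complementary :: "'a action list \<Rightarrow> 'a action list \<Rightarrow> bool" (infix "\<bowtie>" 50) where
  "a \<bowtie> b \<longleftrightarrow> (\<exists>\<alpha>. is_request_on \<alpha> a \<or> is_offer_on \<alpha> a) \<and>
     (\<forall>\<alpha>. is_offer_on \<alpha> a \<longrightarrow> is_request_on (co \<alpha>) b) \<and>
     (\<forall>\<alpha>. is_request_on \<alpha> a \<longrightarrow> is_offer_on (co \<alpha>) b)"

text \<open>The observable of a label; \<open>None\<close> stands for the invisible action $\tau$.\<close>

definition observable :: "'a action list \<Rightarrow> 'a action option" where
  "observable v = (if is_match v then None else Some (THE \<alpha>. \<alpha> \<in> set v \<and> \<alpha> \<noteq> Idle))"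

type_synonym ('s, 'a) transition = "'s list \<times> 'a action list \<times> 's list"

record ('s, 'a) ca =
  components :: "'s set list"
  init :: "'s list"
  requests :: "'a action set"
  offers :: "'a action set"
  transitions :: "('s, 'a) transition set"
  finals :: "'s list set"

definition rank :: "('s, 'a) ca \<Rightarrow> nat" where
  "rank A = length (components A)"

text \<open>\<open>listset [Q\<^sub>1, \<dots>, Q\<^sub>r]\<close> is the product of the \<open>Q\<^sub>i\<close>, as a set of lists of length \<open>r\<close>.\<close>

definition states :: "('s, 'a) ca \<Rightarrow> 's list set" where
  "states A = listset (components A)"

definition contract_automaton :: "('s, 'a) ca \<Rightarrow> bool" where
  "contract_automaton A \<longleftrightarrow>
     finite (states A) \<and> init A \<in> states A \<and> finals A \<subseteq> states A \<and>
     finite (requests A) \<and> requests A \<subseteq> range Req \<and>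
     finite (offers A) \<and> offers A \<subseteq> range Off \<and>
     (\<forall>(q, v, q') \<in> transitions A.
        q \<in> states A \<and> q' \<in> states A \<and>
        length v = rank A \<and> set v \<subseteq> requests A \<union> offers A \<union> {Idle} \<and>
        (is_request v \<or> is_offer v \<or> is_match v) \<and>
        (\<forall>i < rank A. v ! i = Idle \<longrightarrow> q ! i = q' ! i))"

text \<open>
  Weak liability speaks about words, flows speak about transitions; only for deterministic
  automata does a word determine the transitions it traverses.
\<close>

definition deterministic :: "('s, 'a) ca \<Rightarrow> bool" where
  "deterministic A \<longleftrightarrow>
     (\<forall>q v q1 q2. (q, v, q1) \<in> transitions A \<longrightarrow> (q, v, q2) \<in> transitions A \<longrightarrow> q1 = q2)"

inductive path :: "('s, 'a) ca \<Rightarrow> 's list \<Rightarrow> 'a action list list \<Rightarrow> 's list \<Rightarrow> bool"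
  for A where
  path_Nil: "path A q [] q"
| path_Cons: "(q, v, q') \<in> transitions A \<Longrightarrow> path A q' w q'' \<Longrightarrow> path A q (v # w) q''"

definition lang :: "('s, 'a) ca \<Rightarrow> 'a action list list set" where
  "lang A = {w. \<exists>q \<in> finals A. path A (init A) w q}"

text \<open>
  The set of words admitting weak agreement. The function \<open>f\<close> on the indices of \<open>w\<close> is partial:
  it has to be defined on the indices of the requests, and only there is it required to be
  injective.
\<close>

definition weak_agreement :: "'a action list list set" where
  "weak_agreement =
     {w. (\<exists>r > 1. \<forall>v \<in> set w. length v = r) \<and>
         (\<exists>f :: nat \<rightharpoonup> nat. dom f \<subseteq> {..<length w} \<and> ran f \<subseteq> {..<length w} \<and>
            {i. i < length w \<and> is_request (w ! i)} \<subseteq> dom f \<and>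
            inj_on f {i. i < length w \<and> is_request (w ! i)} \<and>
            (\<forall>i j. f i = Some j \<longrightarrow> w ! i \<bowtie> w ! j))}"

text \<open>The word \<open>u\<close> below is the prefix $w_1 \vec a$.\<close>

definition weakly_liable_at :: "('s, 'a) ca \<Rightarrow> 'a action list list \<Rightarrow> nat set" where
  "weakly_liable_at A u =
     {i. i < rank A \<and>
         (\<exists>w1 a w2. u = w1 @ [a] \<and> a ! i \<noteq> Idle \<and>
            w1 @ [a] @ w2 \<in> lang A - weak_agreement \<and>
            (\<forall>w'. (w1 @ [a] @ w2) @ w' \<notin> lang A \<inter> weak_agreement) \<and>
            (\<forall>w3. w1 @ [a] @ w3 \<notin> lang A \<inter> weak_agreement) \<and>
            (\<exists>w4. w1 @ w4 \<in> lang A \<inter> weak_agreement))}"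

definition weakly_liable :: "('s, 'a) ca \<Rightarrow> nat set" where
  "weakly_liable A = {i. \<exists>u. i \<in> weakly_liable_at A u}"

definition flow_setting :: "('s, 'a) ca \<Rightarrow> 's list \<Rightarrow> bool" where
  "flow_setting A qf \<longleftrightarrow> finals A = {qf} \<and> qf \<noteq> init A \<and>
     (\<forall>q \<in> states A. (\<exists>w. path A (init A) w q) \<and> (\<exists>w. path A q w qf))"

definition FS :: "('s, 'a) ca \<Rightarrow> 's list \<Rightarrow> ('s, 'a) transition set" where
  "FS A q = {t \<in> transitions A. fst t = q}"

definition BS :: "('s, 'a) ca \<Rightarrow> 's list \<Rightarrow> ('s, 'a) transition set" where
  "BS A q = {t \<in> transitions A. snd (snd t) = q}"

text \<open>
  \<open>flow_vectors A s d\<close> is $F_{\vec s, \vec d}$. A vector $(x_{t_1}, \dots, x_{t_n})$ is a function on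
  transitions whose values outside \<open>transitions A\<close> play no role. When \<open>s = d\<close>, the demands \<open>-1\<close>
  at the source and \<open>1\<close> at the target fall on the same state and cancel, so the balance is \<open>0\<close>
  everywhere.
\<close>

definition flow_vectors ::
    "('s, 'a) ca \<Rightarrow> 's list \<Rightarrow> 's list \<Rightarrow> (('s, 'a) transition \<Rightarrow> nat) set" where
  "flow_vectors A s d =
     {x. (\<forall>q \<in> states A.
            (\<Sum>t \<in> BS A q. int (x t)) - (\<Sum>t \<in> FS A q. int (x t)) =
              (if s = d then 0 else if q = s then -1 else if q = d then 1 else 0)) \<and>
         (\<exists>z :: 's list \<Rightarrow> ('s, 'a) transition \<Rightarrow> real.
            \<forall>q \<in> states A - {s}.
              let p = (if (\<Sum>t \<in> FS A q. x t) > 0 then 1 else 0 :: real) in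
              (\<forall>t \<in> transitions A. 0 \<le> z q t \<and> z q t \<le> real (x t)) \<and>
              (\<forall>q' \<in> states A.
                 (\<Sum>t \<in> BS A q'. z q t) - (\<Sum>t \<in> FS A q'. z q t) =
                   (if q' = s then - p else if q' = q then p else 0)))}"

text \<open>The coefficient $a^i_t$; requests are indexed by themselves rather than by \<open>1, \<dots>, l\<close>.\<close>

definition coef :: "'a action \<Rightarrow> ('s, 'a) transition \<Rightarrow> int" where
  "coef \<alpha> t = (if observable (fst (snd t)) = Some (co \<alpha>) then 1
               else if observable (fst (snd t)) = Some \<alpha> then -1 else 0)"

text \<open>
  Optimal values are taken in the extended reals, with the usual conventions: an unbounded
  maximisation has value \<open>\<infinity>\<close>, an infeasible minimisation has value \<open>\<infinity>\<close> and an unbounded one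
  \<open>- \<infinity>\<close>. Finite optimal values are attained, since all the coefficients and flows are integers.
\<close>

definition best_completion ::
    "('s, 'a) ca \<Rightarrow> 's list \<Rightarrow> ('s, 'a) transition \<Rightarrow> (('s, 'a) transition \<Rightarrow> nat) \<Rightarrow> ereal" where
  "best_completion A qf tb x =
     Sup {ereal \<gamma> | \<gamma> u. u \<in> flow_vectors A (snd (snd tb)) qf \<and>
        (\<forall>\<alpha> \<in> requests A.
           real_of_int ((\<Sum>t \<in> transitions A. coef \<alpha> t * int (x t + u t)) + coef \<alpha> tb) \<ge> \<gamma>)}"

definition liability_value :: "('s, 'a) ca \<Rightarrow> 's list \<Rightarrow> ('s, 'a) transition \<Rightarrow> ereal" where
  "liability_value A qf tb =
     Inf {best_completion A qf tb x | x y.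
        x \<in> flow_vectors A (init A) (fst tb) \<and> y \<in> flow_vectors A (fst tb) qf \<and>
        (\<forall>\<alpha> \<in> requests A. (\<Sum>t \<in> transitions A. coef \<alpha> t * int (x t + y t)) \<ge> 0)}"

end

theory Submission
  imports Defs
begin

text \<open>
  By Euler's theorem on directed trails, \<open>F\<^bsub>s,d\<^esub>\<close> consists exactly of the vectors of edge
  multiplicities of walks from \<open>s\<close> to \<open>d\<close>: the unit flows \<open>z\<close> express that every state that is used is
  reachable from \<open>s\<close> through used transitions. A word admits weak agreement
  iff each request occurs at most as often as the matching offer, which depends on the
  multiplicities only. So the optimisation problem ranges over words, and its value is integral:
  a negative \<open>g(x)\<close> says that no continuation after the transition agrees.
\<close>

section \<open>Walks in labelled graphs and their balance\<close>

fun walk :: "('v \<times> 'l \<times> 'v) set \<Rightarrow> 'v \<Rightarrow> ('v \<times> 'l \<times> 'v) list \<Rightarrow> 'v \<Rightarrow> bool" where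
  "walk E s [] d \<longleftrightarrow> s = d"
| "walk E s (t # ts) d \<longleftrightarrow> t \<in> E \<and> fst t = s \<and> walk E (snd (snd t)) ts d"

text \<open>A single sum over all edges makes linearity in \<open>x\<close> immediate, and
  self-loops cancel termwise. The ring stays open: integers for multiplicities, reals for the unit
  flows.\<close>

definition net_inflow ::
    "('v \<times> 'l \<times> 'v) set \<Rightarrow> ('v \<times> 'l \<times> 'v \<Rightarrow> 'b::comm_ring_1) \<Rightarrow> 'v \<Rightarrow> 'b" where
  "net_inflow E x q = (\<Sum>t\<in>E. (of_bool (snd (snd t) = q) - of_bool (fst t = q)) * x t)"

lemma walk_append: "walk E s (ts @ us) d \<longleftrightarrow> (\<exists>m. walk E s ts m \<and> walk E m us d)"
  by (induction ts arbitrary: s) auto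

lemma walk_set: "walk E s ts d \<Longrightarrow> set ts \<subseteq> E"
  by (induction ts arbitrary: s) auto

lemma walk_closed:
  assumes "walk E s ts d" "s \<in> V" "\<And>t. t \<in> E \<Longrightarrow> fst t \<in> V \<Longrightarrow> snd (snd t) \<in> V"
  shows "d \<in> V"
  using assms(1,2) by (induction ts arbitrary: s) (auto intro: assms(3))

text \<open>The bridge between vectors and words. With the signed incidence as \<open>g\<close> it
  yields the balance of a walk, with the constant 1 its length, with \<open>coef \<alpha>\<close>
  the surplus of offers over requests.\<close>

lemma sum_count_list:
  fixes g :: "'e \<Rightarrow> 'b::comm_semiring_1"
  assumes "finite E" "set ts \<subseteq> E"
  shows "(\<Sum>t\<in>E. g t * of_nat (count_list ts t)) = (\<Sum>t\<leftarrow>ts. g t)"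
  using assms(2)
proof (induction ts)
  case (Cons a ts)
  have "(\<Sum>t\<in>E. g t * of_nat (count_list (a # ts) t))
      = (\<Sum>t\<in>E. (if t = a then g t else 0) + g t * of_nat (count_list ts t))"
    by (rule sum.cong) (auto simp: algebra_simps)
  also have "\<dots> = g a + (\<Sum>t\<leftarrow>ts. g t)"
    using Cons assms(1) by (simp add: sum.distrib)
  finally show ?case by simp
qed simp

text \<open>The sum along the walk telescopes, and only the ends remain.\<close>

lemma net_inflow_walk:
  assumes "finite E" "walk E s ts d"
  shows "net_inflow E (\<lambda>t. of_nat (count_list ts t)) q = of_bool (q = d) - of_bool (q = s)"
proof -
  have "(\<Sum>t\<leftarrow>ts. of_bool (snd (snd t) = q) - of_bool (fst t = q) :: 'c)
      = of_bool (q = d) - of_bool (q = s)"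
    using assms(2) by (induction ts arbitrary: s) auto
  then show ?thesis
    unfolding net_inflow_def sum_count_list[OF assms(1) walk_set[OF assms(2)]] .
qed

lemma net_inflow_diff:
  "net_inflow E (\<lambda>t. x t - y t) q = net_inflow E x q - net_inflow E y q"
  by (simp add: net_inflow_def right_diff_distrib sum_subtractf)

lemma net_inflow_cong:
  "(\<And>t. t \<in> E \<Longrightarrow> x t = y t) \<Longrightarrow> net_inflow E x q = net_inflow E y q"
  by (simp add: net_inflow_def)

section \<open>Eulerian walks with prescribed multiplicities\<close>

text \<open>Greedy removal: if \<open>s \<noteq> d\<close>, the balance at \<open>s\<close> is -1,
  so some used edge leaves \<open>s\<close>; removing one copy of it moves the source to its target
  and lowers \<open>sum x E\<close>. The walk obtained need not exhaust \<open>x\<close>.\<close>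

lemma exists_walk_below:
  fixes x :: "'v \<times> 'l \<times> 'v \<Rightarrow> nat"
  assumes "finite E"
    and "\<And>q. net_inflow E (\<lambda>t. int (x t)) q = of_bool (q = d) - of_bool (q = s)"
  shows "\<exists>ts. walk E s ts d \<and> (\<forall>t\<in>E. count_list ts t \<le> x t)"
  using assms(2)
proof (induction "sum x E" arbitrary: x s rule: less_induct)
  case less
  show ?case
  proof (cases "s = d")
    case True
    then show ?thesis by (intro exI[of _ "[]"]) simp
  next
    case False
    have "\<exists>t\<in>E. fst t = s \<and> x t > 0"
    proof (rule ccontr)
      assume "\<not> ?thesis"
      then have "net_inflow E (\<lambda>t. int (x t)) s \<ge> 0"
        unfolding net_inflow_def by (intro sum_nonneg) auto
      with less.prems[of s] False show False by simp
    qed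
    then obtain t where t: "t \<in> E" "fst t = s" "x t > 0" by blast
    define x' where "x' = x(t := x t - 1)"
    have "net_inflow E (\<lambda>e. int (x' e)) q = of_bool (q = d) - of_bool (q = snd (snd t))" for q
    proof -
      have "net_inflow E (\<lambda>e. int (x' e)) q
          = net_inflow E (\<lambda>e. int (x e) - int (count_list [t] e)) q"
        by (rule net_inflow_cong) (use t in \<open>auto simp: x'_def\<close>)
      also have "\<dots> = net_inflow E (\<lambda>e. int (x e)) q - net_inflow E (\<lambda>e. int (count_list [t] e)) q"
        by (rule net_inflow_diff)
      also have "net_inflow E (\<lambda>e. int (count_list [t] e)) q
          = of_bool (q = snd (snd t)) - of_bool (q = s)"
        by (rule net_inflow_walk) (use assms(1) t in auto)
      finally show ?thesis using less.prems[of q] by simp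
    qed
    moreover have "sum x' E < sum x E"
      by (rule sum_strict_mono_ex1) (use assms(1) t in \<open>auto simp: x'_def intro!: bexI[of _ t]\<close>)
    ultimately obtain ts where
      ts: "walk E (snd (snd t)) ts d" "\<forall>e\<in>E. count_list ts e \<le> x' e"
      using less.hyps by blast
    have "count_list (t # ts) e \<le> x e" if "e \<in> E" for e
      using ts(2) that t by (auto simp: x'_def dest!: bspec[where x = e] split: if_splits)
    with ts t show ?thesis by (intro exI[of _ "t # ts"]) auto
  qed
qed

text \<open>Euler's theorem for directed trails: a longest walk below \<open>x\<close> uses up \<open>x\<close>, since otherwise
  connectivity gives an unused edge leaving one of its vertices, and a closed walk of unused edges
  through that edge can be spliced in.\<close>

lemma exists_euler_walk:
  fixes x :: "'v \<times> 'l \<times> 'v \<Rightarrow> nat"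
  assumes fin: "finite E"
    and net: "\<And>q. net_inflow E (\<lambda>t. int (x t)) q = of_bool (q = d) - of_bool (q = s)"
    and conn: "\<And>t. t \<in> E \<Longrightarrow> x t > 0 \<Longrightarrow> \<exists>ts. walk {e \<in> E. x e > 0} s ts (fst t)"
  shows "\<exists>ts. walk E s ts d \<and> (\<forall>t\<in>E. count_list ts t = x t)"
proof -
  define P where "P ts \<longleftrightarrow> walk E s ts d \<and> (\<forall>t\<in>E. count_list ts t \<le> x t)" for ts
  \<comment> \<open>\<open>sum x E\<close> bounds the length of all such walks, so a longest one
    exists.\<close>
  have len: "length ts \<le> sum x E" if "P ts" for ts
  proof -
    have "set ts \<subseteq> E" using that walk_set[of E s ts d] by (simp add: P_def)
    from sum_count_list[OF fin this, of "\<lambda>_. 1::nat"]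
    have "length ts = (\<Sum>t\<in>E. count_list ts t)" by (simp add: sum_list_triv)
    also have "\<dots> \<le> sum x E" using that by (intro sum_mono) (auto simp: P_def)
    finally show ?thesis .
  qed
  obtain ts0 where "P ts0"
    using exists_walk_below[OF fin net] unfolding P_def by blast
  then obtain w where w: "P w" and max: "\<And>ts. P ts \<Longrightarrow> length ts \<le> length w"
    using ex_has_greatest_nat[of P ts0 length "sum x E + 1"] len by (auto simp: less_Suc_eq_le)
  define y where "y t = x t - count_list w t" for t
  have wE: "walk E s w d" and wle: "\<And>t. t \<in> E \<Longrightarrow> count_list w t \<le> x t"
    using w by (auto simp: P_def)
  have "y t = 0" if "t \<in> E" for t
  proof (rule ccontr)
    assume "y t \<noteq> 0"
    \<comment> \<open>The vertices visited by \<open>w\<close>, each witnessed by a prefix of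
      \<open>w\<close> that ends there.\<close>
    define V where "V = {v. \<exists>us vs. w = us @ vs \<and> walk E s us v}"
    have "\<exists>e\<in>E. y e > 0 \<and> fst e \<in> V"
    proof (rule ccontr)
      assume no: "\<not> ?thesis"
      from \<open>y t \<noteq> 0\<close> have "x t > 0" by (simp add: y_def)
      then obtain ts where ts: "walk {e \<in> E. x e > 0} s ts (fst t)" using conn \<open>t \<in> E\<close> by blast
      have "fst t \<in> V"
      proof (rule walk_closed[OF ts])
        show "s \<in> V" unfolding V_def by (auto intro: exI[of _ "[]"])
        fix e assume e: "e \<in> {e \<in> E. x e > 0}" "fst e \<in> V"
        with no have "y e = 0" by auto
        with e have "count_list w e > 0" by (simp add: y_def)
        then have "e \<in> set w" by (metis count_notin less_irrefl)
        then obtain us vs where "w = us @ e # vs" by (meson split_list)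
        with wE have "w = (us @ [e]) @ vs" "walk E s (us @ [e]) (snd (snd e))"
          by (auto simp: walk_append)
        then show "snd (snd e) \<in> V" unfolding V_def by blast
      qed
      with no \<open>t \<in> E\<close> \<open>y t \<noteq> 0\<close> show False by auto
    qed
    then obtain e us vs where e: "e \<in> E" "y e > 0" "w = us @ vs" "walk E s us (fst e)"
      unfolding V_def by blast
    then have vs: "walk E (fst e) vs d"
    proof -
      from wE e(3) obtain m where m: "walk E s us m" "walk E m vs d" by (auto simp: walk_append)
      have "m = fst e" using m(1) e(4) by (induction us arbitrary: s) auto
      with m show ?thesis by simp
    qed
    \<comment> \<open>\<open>x\<close> and \<open>w\<close> have the same balance, so
      \<open>y\<close> is a circulation; without one copy of \<open>e\<close> it is a flow from the
      target of \<open>e\<close> back to its source.\<close>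
    define y' where "y' = y(e := y e - 1)"
    have "net_inflow E (\<lambda>t. int (y' t)) q = of_bool (q = fst e) - of_bool (q = snd (snd e))" for q
    proof -
      have "net_inflow E (\<lambda>t. int (y' t)) q
          = net_inflow E (\<lambda>t. int (x t) - int (count_list w t) - int (count_list [e] t)) q"
        by (rule net_inflow_cong) (use wle e(1,2) in \<open>auto simp: y'_def y_def of_nat_diff\<close>)
      also have "\<dots> = net_inflow E (\<lambda>t. int (x t)) q - net_inflow E (\<lambda>t. int (count_list w t)) q
          - net_inflow E (\<lambda>t. int (count_list [e] t)) q"
        by (simp only: net_inflow_diff)
      also have "net_inflow E (\<lambda>t. int (count_list [e] t)) q
          = of_bool (q = snd (snd e)) - of_bool (q = fst e)"
        by (rule net_inflow_walk) (use fin e in auto)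
      also have "net_inflow E (\<lambda>t. int (count_list w t)) q = of_bool (q = d) - of_bool (q = s)"
        by (rule net_inflow_walk[OF fin wE])
      finally show ?thesis using net[of q] by simp
    qed
    from exists_walk_below[OF fin this] obtain c where
      c: "walk E (snd (snd e)) c (fst e)" "\<forall>t\<in>E. count_list c t \<le> y' t" by blast
    have "count_list (us @ e # c @ vs) t \<le> x t" if "t \<in> E" for t
    proof -
      have "count_list c t \<le> y' t" using c(2) that by blast
      moreover have "count_list us t + count_list vs t + y t = x t"
        using wle[OF that] e(3) by (simp add: y_def)
      ultimately show ?thesis using e(2) by (cases "t = e") (auto simp: y'_def)
    qed
    moreover have "walk E s (us @ e # c @ vs) d" using e vs c by (auto simp: walk_append)
    ultimately have "P (us @ e # c @ vs)" by (simp add: P_def)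
    from max[OF this] e(3) show False by simp
  qed
  then have "count_list w t = x t" if "t \<in> E" for t
    using wle[OF that] that by (metis y_def diff_is_0_eq le_antisym)
  with wE show ?thesis by blast
qed

section \<open>Cuts, and reachability from unit flows\<close>

text \<open>Edges with both ends in \<open>R\<close> cancel; what remains is the flow across the
  boundary of \<open>R\<close>.\<close>

lemma net_inflow_cut:
  assumes "finite E" "finite R"
  shows "(\<Sum>q\<in>R. net_inflow E z q)
    = (\<Sum>t\<in>E. (of_bool (snd (snd t) \<in> R) - of_bool (fst t \<in> R)) * z t)"
proof -
  have "(\<Sum>q\<in>R. net_inflow E z q)
      = (\<Sum>t\<in>E. \<Sum>q\<in>R. (of_bool (snd (snd t) = q) - of_bool (fst t = q)) * z t)"
    unfolding net_inflow_def by (rule sum.swap)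
  also have "\<dots> = (\<Sum>t\<in>E. (of_bool (snd (snd t) \<in> R) - of_bool (fst t \<in> R)) * z t)"
  proof (rule sum.cong[OF refl])
    fix t
    have b: "(\<Sum>q\<in>R. of_bool (v = q)) = (of_bool (v \<in> R) :: 'c)" for v
      using assms(2) by (simp add: of_bool_def)
    show "(\<Sum>q\<in>R. (of_bool (snd (snd t) = q) - of_bool (fst t = q)) * z t)
        = (of_bool (snd (snd t) \<in> R) - of_bool (fst t \<in> R)) * z t"
      unfolding sum_distrib_right[symmetric] sum_subtractf b ..
  qed
  finally show ?thesis .
qed

text \<open>A cut argument: if \<open>q\<close> were unreachable, an edge leaving the reachable set
  \<open>R\<close> would have \<open>x t = 0\<close> and hence \<open>z t = 0\<close>, so the net
  flow into \<open>R\<close> would be nonnegative. But \<open>R\<close> contains \<open>s\<close>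
  and not \<open>q\<close>, so its total balance is -1.\<close>

lemma unit_flow_reachable:
  fixes z :: "'v \<times> 'l \<times> 'v \<Rightarrow> real"
  assumes fin: "finite E" "finite V" and V: "\<And>t. t \<in> E \<Longrightarrow> snd (snd t) \<in> V"
    and "s \<in> V" and q: "q \<noteq> s"
    and z: "\<And>t. t \<in> E \<Longrightarrow> 0 \<le> z t \<and> z t \<le> real (x t)"
    and net: "\<And>v. v \<in> V \<Longrightarrow> net_inflow E z v = (if v = s then - 1 else if v = q then 1 else 0)"
  shows "\<exists>ts. walk {e \<in> E. x e > 0} s ts q"
proof (rule ccontr)
  assume no: "\<not> ?thesis"
  define R where "R = {v \<in> V. \<exists>ts. walk {e \<in> E. x e > 0} s ts v}"
  have sR: "s \<in> R" using \<open>s \<in> V\<close> by (auto simp: R_def intro: exI[of _ "[]"])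
  have fR: "finite R" using fin by (simp add: R_def)
  have closed: "snd (snd t) \<in> R" if t: "t \<in> E" "x t > 0" "fst t \<in> R" for t
  proof -
    from t obtain ts where "walk {e \<in> E. x e > 0} s ts (fst t)" by (auto simp: R_def)
    with t have "walk {e \<in> E. x e > 0} s (ts @ [t]) (snd (snd t))" by (auto simp: walk_append)
    with t V show ?thesis by (auto simp: R_def)
  qed
  have "(\<Sum>v\<in>R. net_inflow E z v) \<ge> 0"
    unfolding net_inflow_cut[OF fin(1) fR]
  proof (rule sum_nonneg)
    fix t assume "t \<in> E"
    with z[of t] closed[of t]
    show "0 \<le> (of_bool (snd (snd t) \<in> R) - of_bool (fst t \<in> R)) * z t"
      by (cases "x t > 0") auto
  qed
  moreover have "(\<Sum>v\<in>R. net_inflow E z v) = (\<Sum>v\<in>R. if v = s then - 1 else 0)"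
    by (rule sum.cong) (use no net in \<open>auto simp: R_def\<close>)
  ultimately show False using sR fR by simp
qed

section \<open>Flow vectors as multiplicities of walks\<close>

lemma finite_transitions:
  assumes "contract_automaton A"
  shows "finite (transitions A)"
proof (rule finite_subset)
  let ?L = "{v. set v \<subseteq> requests A \<union> offers A \<union> {Idle} \<and> length v = rank A}"
  show "transitions A \<subseteq> states A \<times> ?L \<times> states A"
    using assms by (fastforce simp: contract_automaton_def)
  show "finite (states A \<times> ?L \<times> states A)"
    using assms by (intro finite_cartesian_product finite_lists_length_eq)
      (auto simp: contract_automaton_def)
qed

lemma transition_states:
  assumes "contract_automaton A" "t \<in> transitions A"
  shows "fst t \<in> states A" "snd (snd t) \<in> states A"
  using assms by (auto simp: contract_automaton_def)

lemma net_inflow_BS_FS: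
  fixes f :: "('s, 'a) transition \<Rightarrow> 'b::comm_ring_1"
  assumes "finite (transitions A)"
  shows "(\<Sum>t\<in>BS A q. f t) - (\<Sum>t\<in>FS A q. f t) = net_inflow (transitions A) f q"
proof -
  have "net_inflow (transitions A) f q
      = (\<Sum>t\<in>transitions A. (if snd (snd t) = q then f t else 0) - (if fst t = q then f t else 0))"
    unfolding net_inflow_def by (rule sum.cong) auto
  then show ?thesis
    using assms by (simp add: BS_def FS_def sum_subtractf sum.inter_filter)
qed

text \<open>From flow to walk: the source \<open>q \<noteq> s\<close> of a used transition has
  positive outflow, so its demand \<open>p\<close> is 1 and \<open>z q\<close> shows that it is
  reachable; Euler's theorem does the rest. From walk to flow: a prefix of the walk that ends in
  \<open>q\<close> serves as \<open>z q\<close>. Equality is asked on transitions only, since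
  \<open>flow_vectors\<close> leaves the other values free.\<close>

lemma flow_vectors_iff_walk:
  assumes A: "contract_automaton A" and sd: "s \<in> states A" "d \<in> states A"
  shows "x \<in> flow_vectors A s d \<longleftrightarrow>
    (\<exists>ts. walk (transitions A) s ts d \<and> (\<forall>t\<in>transitions A. x t = count_list ts t))"
proof
  note fin = finite_transitions[OF A]
  have finV: "finite (states A)" using A by (simp add: contract_automaton_def)
  let ?T = "transitions A"
  have p: "(\<Sum>t\<in>FS A q. x t) > 0 \<longleftrightarrow> (\<exists>t\<in>?T. fst t = q \<and> x t > 0)" for q
  proof -
    have "finite (FS A q)" using fin by (simp add: FS_def)
    then have "(\<Sum>t\<in>FS A q. x t) = 0 \<longleftrightarrow> (\<forall>t\<in>FS A q. x t = 0)" by simp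
    then have "(\<Sum>t\<in>FS A q. x t) > 0 \<longleftrightarrow> (\<exists>t\<in>FS A q. x t > 0)"
      by (metis neq0_conv)
    then show ?thesis unfolding FS_def by blast
  qed
  \<comment> \<open>For \<open>s = d\<close> the two indicators cancel, which covers the zero demand
    of that case.\<close>
  have bal: "(if s = d then 0 else if q = s then -1 else if q = d then 1 else 0)
      = (of_bool (q = d) - of_bool (q = s) :: int)" for q
    by auto
  {
    assume x: "x \<in> flow_vectors A s d"
    show "\<exists>ts. walk ?T s ts d \<and> (\<forall>t\<in>?T. x t = count_list ts t)"
    proof -
      \<comment> \<open>\<open>flow_vectors\<close> gives the balance at states only. Elsewhere no
        transition starts or ends, so it holds for every \<open>q\<close>, as Euler's theorem
        requires.\<close>
      have net: "net_inflow ?T (\<lambda>t. int (x t)) q = of_bool (q = d) - of_bool (q = s)" for q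
      proof (cases "q \<in> states A")
        case True
        then show ?thesis
          using x unfolding flow_vectors_def net_inflow_BS_FS[OF fin] bal by blast
      next
        case False
        then have "net_inflow ?T (\<lambda>t. int (x t)) q = 0"
          unfolding net_inflow_def using transition_states[OF A]
          by (intro sum.neutral) (auto simp: of_bool_def)
        with False sd show ?thesis by auto
      qed
      from x obtain z where z: "\<And>q. q \<in> states A - {s} \<Longrightarrow>
          let p = (if (\<Sum>t\<in>FS A q. x t) > 0 then 1 else 0 :: real) in
              (\<forall>t\<in>?T. 0 \<le> z q t \<and> z q t \<le> real (x t)) \<and>
              (\<forall>q'\<in>states A. net_inflow ?T (z q) q' =
                   (if q' = s then - p else if q' = q then p else 0))"
        unfolding flow_vectors_def net_inflow_BS_FS[OF fin] by blast
      have conn: "\<exists>ts. walk {e \<in> ?T. x e > 0} s ts (fst t)" if t: "t \<in> ?T" "x t > 0" for t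
      proof (cases "fst t = s")
        case True
        then show ?thesis by (auto intro: exI[of _ "[]"])
      next
        case False
        then have q: "fst t \<in> states A - {s}" using transition_states[OF A t(1)] by simp
        have pt: "(\<Sum>e\<in>FS A (fst t). x e) > 0" using t p by blast
        show ?thesis
          by (rule unit_flow_reachable[OF fin finV _ sd(1) False, where z = "z (fst t)"])
            (use z[OF q] pt transition_states[OF A] in \<open>auto simp: Let_def\<close>)
      qed
      show ?thesis using exists_euler_walk[OF fin net conn] by metis
    qed
  next
    assume "\<exists>ts. walk ?T s ts d \<and> (\<forall>t\<in>?T. x t = count_list ts t)"
    then obtain ts where ts: "walk ?T s ts d" "\<And>t. t \<in> ?T \<Longrightarrow> x t = count_list ts t" by blast
    have net: "net_inflow ?T (\<lambda>t. int (x t)) q = of_bool (q = d) - of_bool (q = s)" for q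
    proof -
      have "net_inflow ?T (\<lambda>t. int (x t)) q = net_inflow ?T (\<lambda>t. of_nat (count_list ts t)) q"
        by (rule net_inflow_cong) (simp add: ts(2))
      also have "\<dots> = of_bool (q = d) - of_bool (q = s)" by (rule net_inflow_walk[OF fin ts(1)])
      finally show ?thesis .
    qed
    have "\<forall>q\<in>states A - {s}. \<exists>z.
        let p = (if (\<Sum>t\<in>FS A q. x t) > 0 then 1 else 0 :: real) in
              (\<forall>t\<in>?T. 0 \<le> z t \<and> z t \<le> real (x t)) \<and>
              (\<forall>q'\<in>states A. net_inflow ?T z q' =
                   (if q' = s then - p else if q' = q then p else 0))"
    proof
      fix q assume q: "q \<in> states A - {s}"
      show "\<exists>z. let p = (if (\<Sum>t\<in>FS A q. x t) > 0 then 1 else 0 :: real) in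
              (\<forall>t\<in>?T. 0 \<le> z t \<and> z t \<le> real (x t)) \<and>
              (\<forall>q'\<in>states A. net_inflow ?T z q' =
                   (if q' = s then - p else if q' = q then p else 0))"
      proof (cases "(\<Sum>t\<in>FS A q. x t) > 0")
        case True
        then obtain t where t: "t \<in> ?T" "fst t = q" "x t > 0" unfolding p by blast
        then have "t \<in> set ts" using ts(2) by (metis count_notin less_irrefl)
        \<comment> \<open>The prefix \<open>us\<close> before a transition leaving \<open>q\<close>
          runs from \<open>s\<close> to \<open>q\<close>; its multiplicities form a unit flow below
          \<open>x\<close>.\<close>
        then obtain us vs where us: "ts = us @ t # vs" by (meson split_list)
        with ts(1) t have w: "walk ?T s us q" by (auto simp: walk_append)
        have "net_inflow ?T (\<lambda>t. real (count_list us t)) q' = of_bool (q' = q) - of_bool (q' = s)"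
          for q' by (rule net_inflow_walk[OF fin w])
        then show ?thesis
          by (intro exI[of _ "\<lambda>t. real (count_list us t)"]) (use True ts(2) us q in \<open>auto simp: Let_def\<close>)
      next
        \<comment> \<open>No used transition leaves \<open>q\<close>, so the demand is 0 and the
          zero flow fits.\<close>
        case False
        then show ?thesis
          by (intro exI[of _ "\<lambda>_. 0"]) (simp add: Let_def net_inflow_def)
      qed
    qed
    from bchoice[OF this] show "x \<in> flow_vectors A s d"
      unfolding flow_vectors_def net_inflow_BS_FS[OF fin] bal using net by blast
  }
qed

section \<open>Paths of the automaton as walks\<close>

lemma path_iff_walk:
  "path A q w q' \<longleftrightarrow> (\<exists>ts. walk (transitions A) q ts q' \<and> w = map (fst \<circ> snd) ts)"
proof
  assume "path A q w q'"
  then show "\<exists>ts. walk (transitions A) q ts q' \<and> w = map (fst \<circ> snd) ts"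
  proof induction
    case (path_Nil q)
    then show ?case by (intro exI[of _ "[]"]) simp
  next
    case (path_Cons q v q' w q'')
    then obtain ts where "walk (transitions A) q' ts q'' \<and> w = map (fst \<circ> snd) ts" by blast
    with path_Cons show ?case by (intro exI[of _ "(q, v, q') # ts"]) simp
  qed
next
  have "walk (transitions A) q ts q' \<Longrightarrow> path A q (map (fst \<circ> snd) ts) q'" for ts
    by (induction ts arbitrary: q) (auto intro: path.intros)
  then show "\<exists>ts. walk (transitions A) q ts q' \<and> w = map (fst \<circ> snd) ts \<Longrightarrow> path A q w q'"
    by blast
qed

lemma path_Cons_iff:
  "path A q (a # w) q'' \<longleftrightarrow> (\<exists>q'. (q, a, q') \<in> transitions A \<and> path A q' w q'')"
  by (subst path.simps) auto

lemma path_Nil_iff: "path A q [] q' \<longleftrightarrow> q = q'"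
  by (subst path.simps) auto

lemma path_append: "path A q (u @ v) q'' \<longleftrightarrow> (\<exists>q'. path A q u q' \<and> path A q' v q'')"
  by (induction u arbitrary: q) (auto simp: path_Cons_iff path_Nil_iff)

lemma path_deterministic:
  assumes "deterministic A" "path A q w q1" "path A q w q2"
  shows "q1 = q2"
  using assms(2,3)
proof (induction)
  case (path_Nil q)
  then show ?case by (auto elim: path.cases)
next
  case (path_Cons q v q' w q'')
  from path_Cons.prems show ?case
    by cases (use assms(1) path_Cons in \<open>auto simp: deterministic_def\<close>)
qed

section \<open>Labels, observables and coefficients\<close>

text \<open>The list of non-idle entries separates the kinds of labels: one entry for a request or
  an offer, two for a match. Uniqueness of the action and mutual exclusion follow by comparing these
  lists.\<close>

lemma is_request_on_filter:
  "is_request_on \<alpha> v \<Longrightarrow> filter (\<lambda>x. x \<noteq> Idle) v = [\<alpha>] \<and> \<alpha> \<in> range Req"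
  by (auto simp: is_request_on_def)

lemma is_offer_on_filter:
  "is_offer_on \<alpha> v \<Longrightarrow> filter (\<lambda>x. x \<noteq> Idle) v = [\<alpha>] \<and> \<alpha> \<in> range Off"
  by (auto simp: is_offer_on_def)

lemma is_match_filter: "is_match v \<Longrightarrow> length (filter (\<lambda>x. x \<noteq> Idle) v) = 2"
  by (auto simp: is_match_def is_match_on_def)

lemma is_request_on_unique: "is_request_on \<alpha> v \<Longrightarrow> is_request_on \<beta> v \<Longrightarrow> \<alpha> = \<beta>"
  by (auto dest!: is_request_on_filter)

lemma is_offer_on_unique: "is_offer_on \<alpha> v \<Longrightarrow> is_offer_on \<beta> v \<Longrightarrow> \<alpha> = \<beta>"
  by (auto dest!: is_offer_on_filter)

lemma not_request_and_offer: "is_request_on \<alpha> v \<Longrightarrow> \<not> is_offer_on \<beta> v"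
  by (auto dest!: is_request_on_filter is_offer_on_filter)

lemma observable_eq:
  assumes "filter (\<lambda>x. x \<noteq> Idle) v = [\<alpha>]"
  shows "observable v = Some \<alpha>"
proof -
  have "{x \<in> set v. x \<noteq> Idle} = {\<alpha>}" using arg_cong[OF assms, of set] by simp
  then have "(THE x. x \<in> set v \<and> x \<noteq> Idle) = \<alpha>" by (intro the_equality) auto
  moreover have "\<not> is_match v" using is_match_filter assms by fastforce
  ultimately show ?thesis by (simp add: observable_def)
qed

text \<open>As a difference of indicators, the coefficient sums along a word to offers minus
  requests; matches contribute 0.\<close>

lemma coef_eq:
  assumes "is_request v \<or> is_offer v \<or> is_match v" "\<alpha> \<in> range Req"
  shows "coef \<alpha> (q, v, q') = of_bool (is_offer_on (co \<alpha>) v) - of_bool (is_request_on \<alpha> v)"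
proof -
  consider \<beta> where "is_request_on \<beta> v" | \<beta> where "is_offer_on \<beta> v" | "is_match v"
    using assms(1) by (auto simp: is_request_def is_offer_def)
  then show ?thesis
  proof cases
    case 1
    then have "observable v = Some \<beta>" "\<beta> \<in> range Req"
      using is_request_on_filter observable_eq by blast+
    moreover have "is_request_on \<alpha> v \<longleftrightarrow> \<alpha> = \<beta>" using 1 is_request_on_unique by blast
    ultimately show ?thesis
      using 1 assms(2) not_request_and_offer[OF 1] by (auto simp: coef_def)
  next
    case 2
    then have "observable v = Some \<beta>" "\<beta> \<in> range Off"
      using is_offer_on_filter observable_eq by blast+
    moreover have "is_offer_on (co \<alpha>) v \<longleftrightarrow> co \<alpha> = \<beta>" using 2 is_offer_on_unique by blast
    moreover have "\<not> is_request_on \<alpha> v" using 2 not_request_and_offer by blast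
    ultimately show ?thesis
      using 2 assms(2) by (auto simp: coef_def)
  next
    case 3
    then have "\<not> is_request_on \<alpha> v" "\<not> is_offer_on (co \<alpha>) v"
      by (auto dest!: is_request_on_filter is_offer_on_filter is_match_filter)
    with 3 show ?thesis by (simp add: coef_def observable_def)
  qed
qed

section \<open>Weak agreement by counting\<close>

text \<open>Since \<bowtie> pairs a request only with offers on its complement, the injection
  required by weak agreement splits into one injection per request action, and these exist iff the
  cardinalities allow it. If \<open>\<alpha>\<close> is no request, the left count is 0.\<close>

lemma weak_agreement_iff_count:
  assumes r: "r > 1" and len: "\<And>v. v \<in> set w \<Longrightarrow> length v = r"
  shows "w \<in> weak_agreement \<longleftrightarrow>
    (\<forall>\<alpha>. length (filter (is_request_on \<alpha>) w) \<le> length (filter (is_offer_on (co \<alpha>)) w))"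
proof -
  define I where "I \<alpha> = {i. i < length w \<and> is_request_on \<alpha> (w ! i)}" for \<alpha>
  define J where "J \<alpha> = {i. i < length w \<and> is_offer_on (co \<alpha>) (w ! i)}" for \<alpha>
  have fin: "finite (I \<alpha>)" "finite (J \<alpha>)" for \<alpha> by (auto simp: I_def J_def)
  have req: "{i. i < length w \<and> is_request (w ! i)} = (\<Union>\<alpha>. I \<alpha>)"
    by (auto simp: I_def is_request_def)
  have "w \<in> weak_agreement \<longleftrightarrow> (\<forall>\<alpha>. card (I \<alpha>) \<le> card (J \<alpha>))"
  proof
    assume "w \<in> weak_agreement"
    then have "\<exists>f :: nat \<rightharpoonup> nat. dom f \<subseteq> {..<length w} \<and> ran f \<subseteq> {..<length w} \<and>
        (\<Union>\<alpha>. I \<alpha>) \<subseteq> dom f \<and> inj_on f (\<Union>\<alpha>. I \<alpha>) \<and> (\<forall>i j. f i = Some j \<longrightarrow> w ! i \<bowtie> w ! j)"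
      unfolding weak_agreement_def mem_Collect_eq req by (rule conjunct2)
    then obtain f :: "nat \<rightharpoonup> nat" where f': "dom f \<subseteq> {..<length w} \<and> ran f \<subseteq> {..<length w} \<and>
        (\<Union>\<alpha>. I \<alpha>) \<subseteq> dom f \<and> inj_on f (\<Union>\<alpha>. I \<alpha>) \<and> (\<forall>i j. f i = Some j \<longrightarrow> w ! i \<bowtie> w ! j)"
      by (rule exE)
    then have f: "ran f \<subseteq> {..<length w}" "(\<Union>\<alpha>. I \<alpha>) \<subseteq> dom f" "inj_on f (\<Union>\<alpha>. I \<alpha>)"
      "\<And>i j. f i = Some j \<Longrightarrow> w ! i \<bowtie> w ! j"
      by simp_all
    show "\<forall>\<alpha>. card (I \<alpha>) \<le> card (J \<alpha>)"
    proof
      fix \<alpha>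
      have sub: "f ` I \<alpha> \<subseteq> Some ` J \<alpha>"
      proof
        fix y assume "y \<in> f ` I \<alpha>"
        then obtain i where i: "i \<in> I \<alpha>" "y = f i" by blast
        then obtain j where j: "f i = Some j" using f(2) by blast
        then have "j < length w" using f(1) by (auto intro: ranI)
        moreover have "is_offer_on (co \<alpha>) (w ! j)"
          using f(4)[OF j] i by (auto simp: complementary_def I_def)
        ultimately show "y \<in> Some ` J \<alpha>" using i j by (auto simp: J_def)
      qed
      have "card (I \<alpha>) = card (f ` I \<alpha>)"
        using f(3) by (intro card_image[symmetric]) (auto intro: inj_on_subset)
      also have "\<dots> \<le> card (Some ` J \<alpha>)" using sub fin by (intro card_mono) auto
      also have "\<dots> = card (J \<alpha>)" by (simp add: card_image)
      finally show "card (I \<alpha>) \<le> card (J \<alpha>)" .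
    qed
  next
    assume le: "\<forall>\<alpha>. card (I \<alpha>) \<le> card (J \<alpha>)"
    have "\<forall>\<alpha>. \<exists>g. g ` I \<alpha> \<subseteq> J \<alpha> \<and> inj_on g (I \<alpha>)"
      using le fin by (auto intro!: card_le_inj)
    then obtain g where g: "\<And>\<alpha>. g \<alpha> ` I \<alpha> \<subseteq> J \<alpha>" "\<And>\<alpha>. inj_on (g \<alpha>) (I \<alpha>)" by metis
    \<comment> \<open>\<open>act i\<close> is the unique request at index \<open>i\<close>; it
      selects which of the injections applies.\<close>
    define act where "act i = (SOME \<alpha>. is_request_on \<alpha> (w ! i))" for i
    have act: "act i = \<alpha>" if "i \<in> I \<alpha>" for i \<alpha>
    proof -
      have "is_request_on \<alpha> (w ! i)" using that by (simp add: I_def)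
      moreover from this have "is_request_on (act i) (w ! i)" unfolding act_def by (rule someI)
      ultimately show ?thesis by (rule is_request_on_unique[rotated])
    qed
    \<comment> \<open>Off the request indices \<open>f\<close> is undefined, so the pairing
      condition concerns requests only.\<close>
    define f where "f i = (if i \<in> (\<Union>\<alpha>. I \<alpha>) then Some (g (act i) i) else None)" for i
    have f: "\<exists>\<alpha>. i \<in> I \<alpha> \<and> j = g \<alpha> i \<and> j \<in> J \<alpha>" if "f i = Some j" for i j
      using that g(1) act by (auto simp: f_def split: if_splits)
    have "dom f = (\<Union>\<alpha>. I \<alpha>)" by (auto simp: f_def split: if_splits)
    moreover have "inj_on f (\<Union>\<alpha>. I \<alpha>)"
    proof (rule inj_onI)
      fix i i' assume *: "i \<in> (\<Union>\<alpha>. I \<alpha>)" "i' \<in> (\<Union>\<alpha>. I \<alpha>)" "f i = f i'"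
      then obtain j where j: "f i = Some j" "f i' = Some j" by (auto simp: f_def)
      obtain \<alpha> where \<alpha>: "i \<in> I \<alpha>" "j = g \<alpha> i" "j \<in> J \<alpha>" using f j by blast
      obtain \<beta> where \<beta>: "i' \<in> I \<beta>" "j = g \<beta> i'" "j \<in> J \<beta>" using f j by blast
      \<comment> \<open>Equal images are one and the same offer, so both requests are its complement
        and share one injective \<open>g \<alpha>\<close>.\<close>
      have "co \<alpha> = co \<beta>" using \<alpha>(3) \<beta>(3) by (auto simp: J_def intro: is_offer_on_unique)
      moreover have "\<alpha> \<in> range Req" "\<beta> \<in> range Req"
        using \<alpha>(1) \<beta>(1) by (auto simp: I_def is_request_on_def)
      ultimately have "\<alpha> = \<beta>" by auto
      with \<alpha> \<beta> g(2)[of \<alpha>] show "i = i'" by (auto dest: inj_onD)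
    qed
    moreover have "ran f \<subseteq> {..<length w}"
      by (auto simp: ran_def J_def dest!: f)
    moreover have "w ! i \<bowtie> w ! j" if "f i = Some j" for i j
    proof -
      from f[OF that] obtain \<alpha> where
        "is_request_on \<alpha> (w ! i)" "is_offer_on (co \<alpha>) (w ! j)" by (auto simp: I_def J_def)
      then show ?thesis
        unfolding complementary_def
        using not_request_and_offer[of \<alpha> "w ! i"] is_request_on_unique[of \<alpha> "w ! i"] by blast
    qed
    moreover have "(\<Union>\<alpha>. I \<alpha>) \<subseteq> {..<length w}" by (auto simp: I_def)
    ultimately have f: "dom f \<subseteq> {..<length w} \<and> ran f \<subseteq> {..<length w} \<and> (\<Union>\<alpha>. I \<alpha>) \<subseteq> dom f \<and>
        inj_on f (\<Union>\<alpha>. I \<alpha>) \<and> (\<forall>i j. f i = Some j \<longrightarrow> w ! i \<bowtie> w ! j)"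
      by simp
    show "w \<in> weak_agreement"
      unfolding weak_agreement_def mem_Collect_eq req
      by (intro conjI, use r len in blast, rule exI[of _ f], rule f)
  qed
  then show ?thesis by (simp add: I_def J_def length_filter_conv_card)
qed

text \<open>The counting criterion becomes one linear inequality per element of
  \<open>requests A\<close>, as other requests do not occur on the labels. Rank above 1 supplies the
  common label length that \<open>weak_agreement\<close> asks for.\<close>

lemma weak_agreement_iff_coef:
  assumes A: "contract_automaton A" "rank A > 1" and ts: "set ts \<subseteq> transitions A"
  shows "map (fst \<circ> snd) ts \<in> weak_agreement \<longleftrightarrow>
    (\<forall>\<alpha>\<in>requests A. (\<Sum>t\<leftarrow>ts. coef \<alpha> t) \<ge> 0)"
proof -
  let ?w = "map (fst \<circ> snd) ts"
  have lab: "length v = rank A \<and> set v \<subseteq> requests A \<union> offers A \<union> {Idle}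
      \<and> (is_request v \<or> is_offer v \<or> is_match v)" if "(q, v, q') \<in> transitions A" for q v q'
    using that A(1) unfolding contract_automaton_def by blast
  have RO: "requests A \<subseteq> range Req" "offers A \<subseteq> range Off"
    using A(1) by (auto simp: contract_automaton_def)
  have sum: "(\<Sum>t\<leftarrow>ts. coef \<alpha> t)
      = int (length (filter (is_offer_on (co \<alpha>)) ?w)) - int (length (filter (is_request_on \<alpha>) ?w))"
    if "\<alpha> \<in> range Req" for \<alpha>
    using ts
  proof (induction ts)
    case (Cons t ts)
    obtain q v q' where t: "t = (q, v, q')" by (cases t) auto
    show ?case using Cons coef_eq[OF _ that, of v q q'] lab[of q v q'] t by auto
  qed simp
  have none: "filter (is_request_on \<alpha>) ?w = []" if "\<alpha> \<notin> requests A" for \<alpha>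
  proof (rule ccontr)
    assume "filter (is_request_on \<alpha>) ?w \<noteq> []"
    then obtain t where t: "t \<in> set ts" "is_request_on \<alpha> (fst (snd t))"
      by (auto simp: filter_empty_conv)
    have "\<alpha> \<in> set (filter (\<lambda>x. x \<noteq> Idle) (fst (snd t)))" "\<alpha> \<in> range Req"
      using is_request_on_filter[OF t(2)] by auto
    moreover have "set (fst (snd t)) \<subseteq> requests A \<union> offers A \<union> {Idle}"
      using lab[of "fst t" "fst (snd t)" "snd (snd t)"] t ts by auto
    ultimately show False using that RO by auto
  qed
  have "?w \<in> weak_agreement \<longleftrightarrow>
    (\<forall>\<alpha>. length (filter (is_request_on \<alpha>) ?w) \<le> length (filter (is_offer_on (co \<alpha>)) ?w))"
    by (rule weak_agreement_iff_count[OF A(2)]) (use lab ts in fastforce)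
  also have "\<dots> \<longleftrightarrow> (\<forall>\<alpha>\<in>requests A. (\<Sum>t\<leftarrow>ts. coef \<alpha> t) \<ge> 0)"
  proof -
    have "length (filter (is_request_on \<alpha>) ?w) \<le> length (filter (is_offer_on (co \<alpha>)) ?w)
        \<longleftrightarrow> (\<alpha> \<in> requests A \<longrightarrow> (\<Sum>t\<leftarrow>ts. coef \<alpha> t) \<ge> 0)" for \<alpha>
      using sum[of \<alpha>] none[of \<alpha>] RO by (cases "\<alpha> \<in> requests A") auto
    then show ?thesis by blast
  qed
  finally show ?thesis .
qed

section \<open>Weak liability and the sign of optimal values\<close>

text \<open>Determinism fixes the states \<open>qs\<close> and \<open>qd\<close> reached before and
  after \<open>a\<close>, so the continuations \<open>w4\<close> and \<open>w3\<close> start there.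
  Conversely, \<open>w2\<close> exists because \<open>qf\<close> is reachable from
  \<open>qd\<close>, and the continuations \<open>w2\<close> and \<open>w2 @ w'\<close> are treated
  as cases of \<open>w3\<close>.\<close>

lemma weakly_liable_iff:
  assumes det: "deterministic A" and flow: "flow_setting A qf"
    and A: "contract_automaton A" and k: "k < rank A"
  shows "k \<in> weakly_liable A \<longleftrightarrow>
    (\<exists>qs a qd w w4. (qs, a, qd) \<in> transitions A \<and> a ! k \<noteq> Idle \<and> path A (init A) w qs \<and>
       path A qs w4 qf \<and> w @ w4 \<in> weak_agreement \<and>
       (\<forall>w3. path A qd w3 qf \<longrightarrow> w @ [a] @ w3 \<notin> weak_agreement))" (is "_ \<longleftrightarrow> ?R")
proof
  have lang: "v \<in> lang A \<longleftrightarrow> path A (init A) v qf" for v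
    using flow by (auto simp: lang_def flow_setting_def)
  have single: "path A q [a] q' \<longleftrightarrow> (q, a, q') \<in> transitions A" for q a q'
    by (simp add: path_Cons_iff path_Nil_iff)
  {
    assume "k \<in> weakly_liable A"
    then obtain w a w2 w4 where h: "a ! k \<noteq> Idle" "path A (init A) (w @ [a] @ w2) qf"
      "\<And>w3. w @ [a] @ w3 \<notin> lang A \<inter> weak_agreement" "w @ w4 \<in> lang A \<inter> weak_agreement"
      unfolding weakly_liable_def weakly_liable_at_def lang[symmetric] by blast
    then obtain qs qd where q: "path A (init A) w qs" "(qs, a, qd) \<in> transitions A"
      unfolding path_append single by blast
    obtain qs' where "path A (init A) w qs'" "path A qs' w4 qf"
      using h(4) by (auto simp: lang path_append)
    with q have w4: "path A qs w4 qf" using path_deterministic[OF det] by blast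
    have "w @ [a] @ w3 \<notin> weak_agreement" if "path A qd w3 qf" for w3
    proof -
      have "path A (init A) (w @ [a] @ w3) qf" using q that unfolding path_append single by blast
      with h(3)[of w3] show ?thesis by (simp add: lang)
    qed
    with q w4 h show ?R by blast
  next
    assume ?R
    then obtain qs a qd w w4 where h: "(qs, a, qd) \<in> transitions A" "a ! k \<noteq> Idle"
      "path A (init A) w qs" "path A qs w4 qf" "w @ w4 \<in> weak_agreement"
      "\<And>w3. path A qd w3 qf \<Longrightarrow> w @ [a] @ w3 \<notin> weak_agreement" by blast
    have "qd \<in> states A" using transition_states[OF A h(1)] by simp
    then obtain w2 where "path A qd w2 qf" using flow by (auto simp: flow_setting_def)
    then have w2: "w @ [a] @ w2 \<in> lang A"
      unfolding lang path_append single using h by blast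
    have no: "w @ [a] @ w3 \<notin> lang A \<inter> weak_agreement" for w3
    proof
      assume *: "w @ [a] @ w3 \<in> lang A \<inter> weak_agreement"
      then obtain q q' where "path A (init A) w q" "(q, a, q') \<in> transitions A" "path A q' w3 qf"
        unfolding lang path_append single Int_iff by blast
      moreover from this h have "q = qs" using path_deterministic[OF det] by blast
      ultimately have "path A qd w3 qf" using det h(1) unfolding deterministic_def by blast
      with h(6) * show False by blast
    qed
    have "w @ w4 \<in> lang A \<inter> weak_agreement"
      using h unfolding lang path_append Int_iff by blast
    moreover have "(w @ [a] @ w2) @ w' \<notin> lang A \<inter> weak_agreement" for w'
      using no[of "w2 @ w'"] by simp
    ultimately have "k \<in> weakly_liable_at A (w @ [a])"
      unfolding weakly_liable_at_def using k h(2) w2 no by blast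
    then show "k \<in> weakly_liable A" by (auto simp: weakly_liable_def)
  }
qed

text \<open>If some \<open>u\<close> makes all sums nonnegative, \<open>\<gamma> = 0\<close> is
  feasible; otherwise integrality keeps every feasible \<open>\<gamma>\<close> at or below -1. With
  no \<open>u\<close> at all, the supremum is \<open>-\<infinity>\<close> and both sides
  hold.\<close>

lemma best_completion_less_0_iff:
  "best_completion A qf tb x < 0 \<longleftrightarrow>
    (\<forall>u\<in>flow_vectors A (snd (snd tb)) qf.
       \<exists>\<alpha>\<in>requests A. (\<Sum>t\<in>transitions A. coef \<alpha> t * int (x t + u t)) + coef \<alpha> tb < 0)"
    (is "?L \<longleftrightarrow> ?R")
proof
  let ?c = "\<lambda>u \<alpha>. (\<Sum>t\<in>transitions A. coef \<alpha> t * int (x t + u t)) + coef \<alpha> tb"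
  let ?S = "{ereal \<gamma> | \<gamma> u. u \<in> flow_vectors A (snd (snd tb)) qf \<and>
      (\<forall>\<alpha>\<in>requests A. real_of_int (?c u \<alpha>) \<ge> \<gamma>)}"
  {
    assume L: ?L
    show ?R
    proof (rule ccontr)
      assume "\<not> ?R"
      then obtain u where u: "u \<in> flow_vectors A (snd (snd tb)) qf"
        "\<And>\<alpha>. \<alpha> \<in> requests A \<Longrightarrow> ?c u \<alpha> \<ge> 0"
        by (meson not_less)
      have "\<forall>\<alpha>\<in>requests A. real_of_int (?c u \<alpha>) \<ge> 0"
        using u(2) of_int_0_le_iff by blast
      with u(1) have "ereal 0 \<in> ?S" by blast
      then have "ereal 0 \<le> best_completion A qf tb x"
        unfolding best_completion_def by (rule Sup_upper)
      with L show False by (simp add: zero_ereal_def)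
    qed
  next
    assume R: ?R
    \<comment> \<open>A uniform bound is required, since a supremum of negative reals could still be
      0.\<close>
    have "best_completion A qf tb x \<le> ereal (- 1)"
      unfolding best_completion_def
    proof (rule Sup_least)
      fix y assume "y \<in> ?S"
      then obtain \<gamma> u where u: "y = ereal \<gamma>" "u \<in> flow_vectors A (snd (snd tb)) qf"
        "\<And>\<alpha>. \<alpha> \<in> requests A \<Longrightarrow> real_of_int (?c u \<alpha>) \<ge> \<gamma>" by blast
      then obtain \<alpha> where \<alpha>: "\<alpha> \<in> requests A" "?c u \<alpha> < 0" using R by blast
      then have "real_of_int (?c u \<alpha>) \<le> - 1" by linarith
      with u(3)[OF \<alpha>(1)] u(1) show "y \<le> ereal (- 1)" by simp
    qed
    also have "\<dots> < 0" by (simp add: zero_ereal_def)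
    finally show ?L .
  }
qed

section \<open>Optimal values read as statements about words\<close>

theorem theorem4p17:
  fixes A :: "('s, 'a) ca" and qf :: "'s list" and k :: nat
  assumes "contract_automaton A"
    and "deterministic A"
    and "rank A > 1"
    and "flow_setting A qf"
    and "k < rank A"
  shows "k \<in> weakly_liable A \<longleftrightarrow>
    (\<exists>qs a qd. (qs, a, qd) \<in> transitions A \<and> a ! k \<noteq> Idle \<and>
       liability_value A qf (qs, a, qd) < 0)"
proof -
  let ?T = "transitions A" and ?lab = "map (fst \<circ> snd) :: ('s, 'a) transition list \<Rightarrow> _"
  note A = assms(1)
  have fin: "finite ?T" using finite_transitions[OF A] .
  have q0: "init A \<in> states A" and qf: "qf \<in> states A"
    using A assms(4) by (auto simp: contract_automaton_def flow_setting_def)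
  \<comment> \<open>The two walks need not be adjacent, as multiplicities add regardless of order;
    later the fixed transition stands between them.\<close>
  have sum2: "(\<Sum>t\<in>?T. coef \<alpha> t * int (x t + y t)) = (\<Sum>t\<leftarrow>ts @ us. coef \<alpha> t)"
    if "walk ?T p ts q" "walk ?T p' us q'" "\<forall>t\<in>?T. x t = count_list ts t"
      "\<forall>t\<in>?T. y t = count_list us t" for x y ts us p q p' q' \<alpha>
  proof -
    have "(\<Sum>t\<in>?T. coef \<alpha> t * int (x t + y t))
        = (\<Sum>t\<in>?T. coef \<alpha> t * of_nat (count_list (ts @ us) t))"
      using that by simp
    also have "\<dots> = (\<Sum>t\<leftarrow>ts @ us. coef \<alpha> t)"
      by (rule sum_count_list[OF fin]) (use walk_set[OF that(1)] walk_set[OF that(2)] in auto)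
    finally show ?thesis .
  qed
  have main: "liability_value A qf (qs, a, qd) < 0 \<longleftrightarrow>
      (\<exists>w w4. path A (init A) w qs \<and> path A qs w4 qf \<and> w @ w4 \<in> weak_agreement \<and>
         (\<forall>w3. path A qd w3 qf \<longrightarrow> w @ [a] @ w3 \<notin> weak_agreement))"
    if t: "(qs, a, qd) \<in> ?T" for qs a qd
  proof -
    have qs: "qs \<in> states A" and qd: "qd \<in> states A" using transition_states[OF A t] by auto
    have agree: "(\<forall>\<alpha>\<in>requests A. (\<Sum>t\<in>?T. coef \<alpha> t * int (x t + y t)) \<ge> 0)
        \<longleftrightarrow> ?lab ts @ ?lab us \<in> weak_agreement"
      if "walk ?T p ts q" "walk ?T p' us q'" "\<forall>t\<in>?T. x t = count_list ts t"
        "\<forall>t\<in>?T. y t = count_list us t" for x y ts us p q p' q'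
      unfolding sum2[OF that] map_append[symmetric]
      by (rule weak_agreement_iff_coef[OF A assms(3), symmetric]) (use walk_set[OF that(1)] walk_set[OF that(2)] in auto)
    \<comment> \<open>Any walk \<open>ts\<close> realising \<open>x\<close> may be taken, as
      agreement depends on multiplicities only.\<close>
    have best: "best_completion A qf (qs, a, qd) x < 0
        \<longleftrightarrow> (\<forall>w3. path A qd w3 qf \<longrightarrow> ?lab ts @ [a] @ w3 \<notin> weak_agreement)"
      if ts: "walk ?T (init A) ts qs" "\<forall>t\<in>?T. x t = count_list ts t" for x ts
    proof -
      have one: "(\<exists>\<alpha>\<in>requests A. (\<Sum>t\<in>?T. coef \<alpha> t * int (x t + u t)) + coef \<alpha> (qs, a, qd) < 0)
          \<longleftrightarrow> ?lab ts @ [a] @ ?lab us \<notin> weak_agreement"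
        if us: "walk ?T qd us qf" "\<forall>t\<in>?T. u t = count_list us t" for u us
      proof -
        have "set (ts @ (qs, a, qd) # us) \<subseteq> ?T" using walk_set[OF ts(1)] walk_set[OF us(1)] t by auto
        from weak_agreement_iff_coef[OF A assms(3) this]
        have wa: "?lab ts @ [a] @ ?lab us \<in> weak_agreement \<longleftrightarrow>
            (\<forall>\<alpha>\<in>requests A. (\<Sum>t\<leftarrow>ts @ (qs, a, qd) # us. coef \<alpha> t) \<ge> 0)"
          by simp
        have eq: "(\<Sum>t\<leftarrow>ts @ us. coef \<alpha> t) + coef \<alpha> (qs, a, qd)
            = (\<Sum>t\<leftarrow>ts @ (qs, a, qd) # us. coef \<alpha> t)" for \<alpha>
          by simp
        show ?thesis
          unfolding sum2[OF ts(1) us(1) ts(2) us(2)] eq wa by (meson not_le)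
      qed
      show ?thesis
      proof
        assume L: "best_completion A qf (qs, a, qd) x < 0"
        show "\<forall>w3. path A qd w3 qf \<longrightarrow> ?lab ts @ [a] @ w3 \<notin> weak_agreement"
        proof (intro allI impI)
          fix w3 assume "path A qd w3 qf"
          then obtain us where us: "walk ?T qd us qf" "w3 = ?lab us"
            unfolding path_iff_walk by blast
          have "count_list us \<in> flow_vectors A qd qf"
            using us flow_vectors_iff_walk[OF A qd qf, of "count_list us"] by blast
          with L one[OF us(1), of "count_list us"] us(2)
          show "?lab ts @ [a] @ w3 \<notin> weak_agreement"
            unfolding best_completion_less_0_iff by simp
        qed
      next
        assume R: "\<forall>w3. path A qd w3 qf \<longrightarrow> ?lab ts @ [a] @ w3 \<notin> weak_agreement"
        show "best_completion A qf (qs, a, qd) x < 0"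
          unfolding best_completion_less_0_iff
        proof
          fix u assume "u \<in> flow_vectors A (snd (snd (qs, a, qd))) qf"
          then obtain us where us: "walk ?T qd us qf" "\<forall>t\<in>?T. u t = count_list us t"
            using flow_vectors_iff_walk[OF A qd qf, of u] by auto
          then have "path A qd (?lab us) qf" unfolding path_iff_walk by blast
          with R one[OF us]
          show "\<exists>\<alpha>\<in>requests A.
              (\<Sum>t\<in>?T. coef \<alpha> t * int (x t + u t)) + coef \<alpha> (qs, a, qd) < 0" by blast
        qed
      qed
    qed
    \<comment> \<open>An infimum lies below 0 iff some member does, so no minimiser has to be
      exhibited.\<close>
    have "liability_value A qf (qs, a, qd) < 0 \<longleftrightarrow>
        (\<exists>x y. x \<in> flow_vectors A (init A) qs \<and> y \<in> flow_vectors A qs qf \<and>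
          (\<forall>\<alpha>\<in>requests A. (\<Sum>t\<in>?T. coef \<alpha> t * int (x t + y t)) \<ge> 0) \<and>
          best_completion A qf (qs, a, qd) x < 0)"
      unfolding liability_value_def Inf_less_iff by (simp only: fst_conv) blast
    also have "\<dots> \<longleftrightarrow> (\<exists>w w4. path A (init A) w qs \<and> path A qs w4 qf \<and> w @ w4 \<in> weak_agreement \<and>
         (\<forall>w3. path A qd w3 qf \<longrightarrow> w @ [a] @ w3 \<notin> weak_agreement))" (is "?L = ?R")
    proof
      assume ?L
      then obtain x y where xy: "x \<in> flow_vectors A (init A) qs" "y \<in> flow_vectors A qs qf"
        "\<forall>\<alpha>\<in>requests A. (\<Sum>t\<in>?T. coef \<alpha> t * int (x t + y t)) \<ge> 0"
        "best_completion A qf (qs, a, qd) x < 0" by blast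
      obtain ts where ts: "walk ?T (init A) ts qs" "\<forall>t\<in>?T. x t = count_list ts t"
        using xy(1) flow_vectors_iff_walk[OF A q0 qs, of x] by blast
      obtain us where us: "walk ?T qs us qf" "\<forall>t\<in>?T. y t = count_list us t"
        using xy(2) flow_vectors_iff_walk[OF A qs qf, of y] by blast
      have "path A (init A) (?lab ts) qs" "path A qs (?lab us) qf"
        using ts us unfolding path_iff_walk by blast+
      with xy(3,4) agree[OF ts(1) us(1) ts(2) us(2)] best[OF ts] show ?R by blast
    next
      assume ?R
      then obtain w w4 where w: "path A (init A) w qs" "path A qs w4 qf" "w @ w4 \<in> weak_agreement"
        "\<forall>w3. path A qd w3 qf \<longrightarrow> w @ [a] @ w3 \<notin> weak_agreement" by blast
      obtain ts where ts: "walk ?T (init A) ts qs" "w = ?lab ts"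
        using w(1) unfolding path_iff_walk by blast
      obtain us where us: "walk ?T qs us qf" "w4 = ?lab us"
        using w(2) unfolding path_iff_walk by blast
      \<comment> \<open>The multiplicity vectors of the two walks serve as \<open>x\<close> and
        \<open>y\<close>.\<close>
      have "count_list ts \<in> flow_vectors A (init A) qs" "count_list us \<in> flow_vectors A qs qf"
        using ts us flow_vectors_iff_walk[OF A q0 qs, of "count_list ts"]
          flow_vectors_iff_walk[OF A qs qf, of "count_list us"] by blast+
      with w(3,4) ts us agree[OF ts(1) us(1), of "count_list ts" "count_list us"]
        best[OF ts(1), of "count_list ts"]
      show ?L by blast
    qed
    finally show ?thesis .
  qed
  show ?thesis
    unfolding weakly_liable_iff[OF assms(2,4,1,5)] using main by blast
qed

end
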